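(* Let $d\ge1$, $p_0\in(0,1/2)$, let $\mathcal S\subseteq\mathcal G_d$, let $(\lambda^{\mathrm{target}}_{J,\tau})_{(J,\tau)\in\mathcal S}$ be prescribed real values, and let $\omega_{J,\tau}>0$ for all $(J,\tau)\in\mathcal S$ be strictly positive calibration weights. Consider the problem, in the variables $w_{I,\sigma}$ ($(I,\sigma)\in\mathcal G_d$) and $r^+_{J,\tau},r^-_{J,\tau}$ ($(J,\tau)\in\mathcal S$), of minimizing $$\sum_{(J,\tau)\in\mathcal S}\omega_{J,\tau}\bigl(r^+_{J,\tau}+r^-_{J,\tau}\bigr)$$ subject to $w_{I,\sigma}\ge0$ for all $(I,\sigma)\in\mathcal G_d$; $r^+_{J,\tau}\ge0$, $r^-_{J,\tau}\ge0$ and $$\sum_{I\supseteq J}\ \sum_{\sigma\in\{\mathrm L,\mathrm U\}^I:\,\sigma|_J=\tau}w_{I,\sigma}-\lambda^{\mathrm{target}}_{J,\tau}=r^+_{J,\tau}-r^-_{J,\tau}\quad\text{for all }(J,\tau)\in\mathcal S;$$ $$\sum_{(I,\sigma)\in\mathcal G_d:\ i\in I,\ \sigma_i=\mathrm L}w_{I,\sigma}=1,\qquad\sum_{(I,\sigma)\in\mathcal G_d:\ i\in I,\ \sigma_i=\mathrm U}w_{I,\sigma}=1,\qquad i=1,\dots,d;$$ and $\sum_{(I,\sigma)\in\mathcal G_d}w_{I,\sigma}\le 1/p_0$. This problem is a linear program, and its optimal value is zero if and only if the target specification $(\lambda^{\mathrm{target}}_{J,\tau})_{(J,\tau)\in\mathcal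 S}$ is exactly realizable within the witness class at scale $p_0$.
   Context: $[d]=\{1,\dots,d\}$; $\mathcal G_d=\{(I,\sigma):\emptyset\ne I\subseteq[d],\ \sigma\in\{\mathrm L,\mathrm U\}^I\}$, where $\{\mathrm L,\mathrm U\}^I$ is the set of functions $I\to\{\mathrm L,\mathrm U\}$. Geometric witness copula at scale $p_0$. For $(I,\sigma)\in\mathcal G_d$ let $\mu_{I,\sigma}^{(p_0)}$ be the law of $(U_1,\dots,U_d)$ with $U_i=p_0Z$ if $i\in I,\sigma_i=\mathrm L$; $U_i=1-p_0Z$ if $i\in I,\sigma_i=\mathrm U$; $U_i=p_0+(1-2p_0)V_i$ if $i\notin I$, where $Z$ and the $V_i$ are independent and uniform on $[0,1]$. Let $\mu_0^{(p_0)}$ be the law of $(p_0+(1-2p_0)V_i)_{i=1}^d$ with $V_i$ i.i.d. uniform on $[0,1]$. For a nonnegative weight system $v=(v_{I,\sigma})_{(I,\sigma)\in\mathcal G_d}$ with $m_0=1-p_0\sum v_{I,\sigma}\ge0$, put $\mu^{(v,p_0)}=m_0\mu_0^{(p_0)}+\sum_{(I,\sigma)\in\mathcal G_d}p_0v_{I,\sigma}\,\mu_{I,\sigma}^{(p_0)}$. If $\mu^{(v,p_0)}$ has uniform one-dimensional margins, its distribution function $C^{(v,p_0)}$ is called a geometric witness copula at scale $p_0$. For $U\sim C$ put $\lambda^{(p_0)}_{J,\tau}(C)=\frac1{p_0}\Pr(U_i\le p_0\ \forall i\in J\text{ with }\tau_i=\mathrm L,\ U_i\ge1-p_0\ \forall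 i\in J\text{ with }\tau_i=\mathrm U)$. A target specification is exactly realizable within the witness class at scale $p_0$ if there is a geometric witness copula $C$ at scale $p_0$ with $\lambda^{(p_0)}_{J,\tau}(C)=\lambda^{\mathrm{target}}_{J,\tau}$ for all $(J,\tau)\in\mathcal S$. *)

theory Defs
  imports "HOL-Probability.Probability"
begin

text \<open>The index set \<open>[d]\<close> is the universe of a finite type \<open>'n\<close> (so \<open>d = CARD('n) \<ge> 1\<close>), and
  points of \<open>\<real>\<^sup>d\<close> have type \<open>real ^ 'n\<close>. Functions with domain \<open>I\<close> are extensional functions, so
  that \<open>\<sigma>|\<^sub>J\<close> is \<open>restrict \<sigma> J\<close>.\<close>

datatype side = Lower | Upper

type_synonym 'n geometry = "'n set \<times> ('n \<Rightarrow> side)"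

definition geometries :: "'n geometry set" where
  "geometries = {(I, \<sigma>). I \<noteq> {} \<and> \<sigma> \<in> I \<rightarrow>\<^sub>E UNIV}"

text \<open>The order on \<open>real ^ 'n\<close> is componentwise, so \<open>{..a}\<close> is the lower orthant at \<open>a\<close>.\<close>

definition joint_cdf :: "(real ^ 'n::finite) measure \<Rightarrow> real ^ 'n \<Rightarrow> real" where
  "joint_cdf M a = measure M {..a}"

text \<open>The law of \<open>U \<sim> C\<close>; it is uniquely determined by \<open>C\<close>, see \<open>law_of_joint_cdf\<close> below.\<close>

definition law_of :: "(real ^ 'n::finite \<Rightarrow> real) \<Rightarrow> (real ^ 'n) measure" where
  "law_of C = (THE M. prob_space M \<and> sets M = sets borel \<and> joint_cdf M = C)"

lemma joint_cdf_inject: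
  fixes M N :: "(real ^ 'n::finite) measure"
  assumes "prob_space M" "sets M = sets borel" "prob_space N" "sets N = sets borel"
    and "joint_cdf M = joint_cdf N"
  shows "M = N"
proof -
  interpret M: prob_space M by fact
  interpret N: prob_space N by fact
  let ?E = "range (\<lambda>a :: real ^ 'n. {..a})"
  let ?A = "\<lambda>k :: nat. {..(\<chi> i. real k) :: real ^ 'n}"
  show ?thesis
  proof (rule measure_eqI_generator_eq[where E = ?E and \<Omega> = UNIV and A = ?A])
    have "{..a} \<inter> {..b} = {..(\<chi> i. min (a $ i) (b $ i))}" for a b :: "real ^ 'n"
      by (auto simp: less_eq_vec_def)
    then show "Int_stable ?E"
      by (auto simp: Int_stable_def)
    fix X assume "X \<in> ?E"
    then show "emeasure M X = emeasure N X"
      using fun_cong[OF assms(5)]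
      by (auto simp: joint_cdf_def M.emeasure_eq_measure N.emeasure_eq_measure)
  next
    have "\<exists>k. x \<in> ?A k" for x :: "real ^ 'n"
    proof -
      obtain k :: nat where "norm x \<le> real k" using real_arch_simple by blast
      then have "x $ i \<le> real k" for i
        using component_le_norm_cart[of x i] by linarith
      then show ?thesis by (auto simp: less_eq_vec_def)
    qed
    then show "(\<Union>k. ?A k) = UNIV" by blast
  qed (auto simp: assms borel_eq_atMost)
qed

lemma law_of_joint_cdf:
  assumes "prob_space M" "sets M = sets borel"
  shows "law_of (joint_cdf M) = M"
  unfolding law_of_def using assms by (intro the_equality) (auto intro: joint_cdf_inject)

abbreviation uniform01 :: "real measure" where
  "uniform01 \<equiv> uniform_measure lborel {0..1}"

text \<open>The variable \<open>Z\<close> is the first component of the product and the \<open>V\<^sub>i\<close> make up the second; the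
  \<open>V\<^sub>i\<close> with \<open>i \<in> I\<close> are not used.\<close>

definition witness_component :: "real \<Rightarrow> 'n geometry \<Rightarrow> (real ^ 'n::finite) measure" where
  "witness_component p\<^sub>0 = (\<lambda>(I, \<sigma>).
     distr (uniform01 \<Otimes>\<^sub>M (\<Pi>\<^sub>M i\<in>UNIV. uniform01)) borel
       (\<lambda>(z, V). \<chi> i.
          if i \<in> I then (case \<sigma> i of Lower \<Rightarrow> p\<^sub>0 * z | Upper \<Rightarrow> 1 - p\<^sub>0 * z)
          else p\<^sub>0 + (1 - 2 * p\<^sub>0) * V i))"

definition bulk_component :: "real \<Rightarrow> (real ^ 'n::finite) measure" where
  "bulk_component p\<^sub>0 =
     distr (\<Pi>\<^sub>M i\<in>UNIV. uniform01) borel (\<lambda>V. \<chi> i. p\<^sub>0 + (1 - 2 * p\<^sub>0) * V i)"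

definition bulk_mass :: "real \<Rightarrow> ('n::finite geometry \<Rightarrow> real) \<Rightarrow> real" where
  "bulk_mass p\<^sub>0 v = 1 - p\<^sub>0 * (\<Sum>g\<in>geometries. v g)"

definition witness_measure ::
    "real \<Rightarrow> ('n geometry \<Rightarrow> real) \<Rightarrow> (real ^ 'n::finite) measure" where
  "witness_measure p\<^sub>0 v = measure_of UNIV (sets borel)
     (\<lambda>A. ennreal (bulk_mass p\<^sub>0 v) * emeasure (bulk_component p\<^sub>0) A
        + (\<Sum>g\<in>geometries. ennreal (p\<^sub>0 * v g) * emeasure (witness_component p\<^sub>0 g) A))"

lemma sets_witness_measure: "sets (witness_measure p\<^sub>0 v) = sets borel"
  using sets.sigma_sets_eq[of "borel :: (real ^ 'a) measure"]
  by (simp add: witness_measure_def)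

text \<open>The set function in the definition is a measure, so \<open>measure_of\<close> does not collapse it.\<close>

lemma emeasure_witness_measure:
  assumes "A \<in> sets borel"
  shows "emeasure (witness_measure p\<^sub>0 v) A =
     ennreal (bulk_mass p\<^sub>0 v) * emeasure (bulk_component p\<^sub>0) A
        + (\<Sum>g\<in>geometries. ennreal (p\<^sub>0 * v g) * emeasure (witness_component p\<^sub>0 g) A)"
proof (rule emeasure_measure_of[OF witness_measure_def])
  let ?\<mu> = "\<lambda>A. ennreal (bulk_mass p\<^sub>0 v) * emeasure (bulk_component p\<^sub>0) A
        + (\<Sum>g\<in>geometries. ennreal (p\<^sub>0 * v g) * emeasure (witness_component p\<^sub>0 g) A)"
  have bulk: "(\<Sum>i. emeasure (bulk_component p\<^sub>0) (F i)) = emeasure (bulk_component p\<^sub>0) (\<Union>i. F i)"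
    if "range F \<subseteq> sets borel" "disjoint_family F" for F :: "nat \<Rightarrow> (real ^ 'a) set"
    using that by (intro suminf_emeasure) (auto simp: bulk_component_def)
  have wit: "(\<Sum>i. emeasure (witness_component p\<^sub>0 g) (F i)) = emeasure (witness_component p\<^sub>0 g) (\<Union>i. F i)"
    if "range F \<subseteq> sets borel" "disjoint_family F" for F :: "nat \<Rightarrow> (real ^ 'a) set" and g
    using that by (intro suminf_emeasure) (auto simp: witness_component_def split: prod.split)
  have "(\<Sum>i. ?\<mu> (F i)) = ?\<mu> (\<Union>i. F i)"
    if "range F \<subseteq> sets borel" "disjoint_family F" for F :: "nat \<Rightarrow> (real ^ 'a) set"
    by (simp add: suminf_add[symmetric] suminf_sum bulk[OF that] wit[OF that])
  then show "countably_additive (sets (witness_measure p\<^sub>0 v)) ?\<mu>"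
    by (simp add: countably_additive_def sets_witness_measure)
qed (auto simp: positive_def sets_witness_measure assms)

definition uniform_margins :: "(real ^ 'n::finite) measure \<Rightarrow> bool" where
  "uniform_margins M \<longleftrightarrow> (\<forall>i. distr M borel (\<lambda>x. x $ i) = uniform01)"

definition geometric_witness_copula :: "real \<Rightarrow> (real ^ 'n::finite \<Rightarrow> real) \<Rightarrow> bool" where
  "geometric_witness_copula p\<^sub>0 C \<longleftrightarrow>
     (\<exists>v. (\<forall>g\<in>geometries. 0 \<le> v g) \<and> 0 \<le> bulk_mass p\<^sub>0 v \<and>
          uniform_margins (witness_measure p\<^sub>0 v) \<and> C = joint_cdf (witness_measure p\<^sub>0 v))"

definition tail_coefficient ::
    "real \<Rightarrow> (real ^ 'n::finite \<Rightarrow> real) \<Rightarrow> 'n geometry \<Rightarrow> real" where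
  "tail_coefficient p\<^sub>0 C = (\<lambda>(J, \<tau>).
     1 / p\<^sub>0 * measure (law_of C)
       {u. (\<forall>i\<in>J. \<tau> i = Lower \<longrightarrow> u $ i \<le> p\<^sub>0) \<and> (\<forall>i\<in>J. \<tau> i = Upper \<longrightarrow> u $ i \<ge> 1 - p\<^sub>0)})"

definition exactly_realizable ::
    "real \<Rightarrow> 'n::finite geometry set \<Rightarrow> ('n geometry \<Rightarrow> real) \<Rightarrow> bool" where
  "exactly_realizable p\<^sub>0 S target \<longleftrightarrow>
     (\<exists>C. geometric_witness_copula p\<^sub>0 C \<and> (\<forall>g\<in>S. tail_coefficient p\<^sub>0 C g = target g))"

record 'v minimization_problem =
  variables :: "'v set"
  feasible :: "('v \<Rightarrow> real) set"
  objective :: "('v \<Rightarrow> real) \<Rightarrow> real"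

text \<open>Assignments of real values to the variables are extensional functions on the variable set.\<close>

definition is_linear_program :: "'v minimization_problem \<Rightarrow> bool" where
  "is_linear_program P \<longleftrightarrow>
     finite (variables P) \<and>
     (\<exists>c. \<forall>x \<in> variables P \<rightarrow>\<^sub>E UNIV. objective P x = (\<Sum>j\<in>variables P. c j * x j)) \<and>
     (\<exists>(eqs :: (('v \<Rightarrow> real) \<times> real) set) (ineqs :: (('v \<Rightarrow> real) \<times> real) set).
        finite eqs \<and> finite ineqs \<and>
        feasible P = {x \<in> variables P \<rightarrow>\<^sub>E UNIV.
          (\<forall>(a, b)\<in>eqs. (\<Sum>j\<in>variables P. a j * x j) = b) \<and>
          (\<forall>(a, b)\<in>ineqs. (\<Sum>j\<in>variables P. a j * x j) \<le> b)})"

text \<open>The optimal value lives in the extended reals: it is \<open>\<infinity>\<close> for an infeasible problem and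
  \<open>-\<infinity>\<close> for an unbounded one.\<close>

definition optimal_value :: "'v minimization_problem \<Rightarrow> ereal" where
  "optimal_value P = (INF x\<in>feasible P. ereal (objective P x))"

datatype 'n calibration_var =
  Weight "'n geometry" | ResidualPos "'n geometry" | ResidualNeg "'n geometry"

definition calibration_problem ::
    "real \<Rightarrow> 'n::finite geometry set \<Rightarrow> ('n geometry \<Rightarrow> real) \<Rightarrow> ('n geometry \<Rightarrow> real)
      \<Rightarrow> 'n calibration_var minimization_problem" where
  "calibration_problem p\<^sub>0 S target \<omega> =
     (let vars = Weight ` geometries \<union> ResidualPos ` S \<union> ResidualNeg ` S in
      \<lparr>variables = vars,
       feasible = {x \<in> vars \<rightarrow>\<^sub>E UNIV.
         (\<forall>g\<in>geometries. 0 \<le> x (Weight g)) \<and>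
         (\<forall>(J, \<tau>)\<in>S. 0 \<le> x (ResidualPos (J, \<tau>)) \<and> 0 \<le> x (ResidualNeg (J, \<tau>)) \<and>
            (\<Sum>I | J \<subseteq> I. \<Sum>\<sigma> | \<sigma> \<in> I \<rightarrow>\<^sub>E UNIV \<and> restrict \<sigma> J = \<tau>. x (Weight (I, \<sigma>)))
              - target (J, \<tau>)
            = x (ResidualPos (J, \<tau>)) - x (ResidualNeg (J, \<tau>))) \<and>
         (\<forall>i. (\<Sum>(I, \<sigma>) | (I, \<sigma>) \<in> geometries \<and> i \<in> I \<and> \<sigma> i = Lower. x (Weight (I, \<sigma>))) = 1) \<and>
         (\<forall>i. (\<Sum>(I, \<sigma>) | (I, \<sigma>) \<in> geometries \<and> i \<in> I \<and> \<sigma> i = Upper. x (Weight (I, \<sigma>))) = 1) \<and>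
         (\<Sum>g\<in>geometries. x (Weight g)) \<le> 1 / p\<^sub>0},
       objective = (\<lambda>x. \<Sum>g\<in>S. \<omega> g * (x (ResidualPos g) + x (ResidualNeg g)))\<rparr>)"

end

theory Submission
  imports Defs
begin

text \<open>
  Both sides of the equivalence turn out to speak about the same weights. Almost surely under the
  component of a geometry \<open>(I, \<sigma>)\<close>, a coordinate \<open>i \<in> I\<close> lies strictly inside the tail named by
  \<open>\<sigma> i\<close> and a coordinate \<open>i \<notin> I\<close> lies strictly between the two tails. The joint tail event of
  \<open>(J, \<tau>)\<close> therefore has probability 1 under the component of \<open>(I, \<sigma>)\<close> if \<open>(I, \<sigma>)\<close> extends
  \<open>(J, \<tau>)\<close>, and 0 otherwise; the bulk does not charge it because \<open>J\<close> is nonempty. So the tail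
  coefficient of the mixture at \<open>(J, \<tau>)\<close> is the total weight of the extensions of \<open>(J, \<tau>)\<close>
  (\<open>tail_coefficient_witness_measure\<close>), which is the left-hand side of the calibration equation.

  The margins of the mixture are uniform exactly if the weights satisfy the side equations of the
  program (\<open>uniform_margins_witness_measure_iff\<close>). They are necessary by the previous computation
  for singletons \<open>J\<close>. They are sufficient because each margin of each component is uniform on one
  of \<open>[0, p]\<close>, \<open>[p, 1 - p]\<close>, \<open>[1 - p, 1]\<close>: the side equations give the outer intervals the masses
  \<open>p\<close>, hence the middle one the mass \<open>1 - 2 p\<close>, and these are their lengths. As \<open>m\<^sub>0 \<ge> 0\<close> is the
  bound \<open>1 / p\<close> on the total weight, exact realizability means that some admissible weight system
  hits all the targets (\<open>exactly_realizable_iff\<close>).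

  For fixed weights the best residuals are the positive and negative parts of the calibration
  errors, so the optimal value is the infimum over the admissible weights of the weighted absolute
  error (\<open>optimal_value_calibration_problem\<close>). That error is continuous and the admissible weights
  form a compact set, so an infimum of 0 is attained, and as all calibration weights are positive, an
  error of 0 means that every target is hit. If there are no admissible weights, the infimum is
  \<open>\<infinity>\<close> and nothing is realizable.
\<close>

section \<open>Recognizing linear programs\<close>

definition linear_form :: "'v set \<Rightarrow> (('v \<Rightarrow> real) \<Rightarrow> real) \<Rightarrow> bool" where
  "linear_form V F \<longleftrightarrow> (\<exists>a. \<forall>x. F x = (\<Sum>j\<in>V. a j * x j))"

lemma linear_form_variable:
  assumes "finite V" "j \<in> V"
  shows "linear_form V (\<lambda>x. x j)"
  unfolding linear_form_def
proof (intro exI allI)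
  fix x :: "'a \<Rightarrow> real"
  show "x j = (\<Sum>k\<in>V. (if k = j then 1 else 0) * x k)"
    using assms by (simp add: if_distrib[of "\<lambda>c. c * _"] sum.delta cong: if_cong)
qed

lemma linear_form_add:
  assumes "linear_form V F" "linear_form V G"
  shows "linear_form V (\<lambda>x. F x + G x)"
proof -
  obtain a b where "\<And>x. F x = (\<Sum>j\<in>V. a j * x j)" "\<And>x. G x = (\<Sum>j\<in>V. b j * x j)"
    using assms unfolding linear_form_def by blast
  then have "F x + G x = (\<Sum>j\<in>V. (a j + b j) * x j)" for x
    by (simp add: sum.distrib distrib_right)
  then show ?thesis
    unfolding linear_form_def by (intro exI[of _ "\<lambda>j. a j + b j"]) simp
qed

lemma linear_form_scale:
  assumes "linear_form V F"
  shows "linear_form V (\<lambda>x. c * F x)"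
proof -
  obtain a where "\<And>x. F x = (\<Sum>j\<in>V. a j * x j)"
    using assms unfolding linear_form_def by blast
  then have "c * F x = (\<Sum>j\<in>V. (c * a j) * x j)" for x
    by (simp add: sum_distrib_left mult.assoc)
  then show ?thesis
    unfolding linear_form_def by (intro exI[of _ "\<lambda>j. c * a j"]) simp
qed

lemma linear_form_diff:
  assumes "linear_form V F" "linear_form V G"
  shows "linear_form V (\<lambda>x. F x - G x)"
  using linear_form_add[OF assms(1) linear_form_scale[OF assms(2), of "-1"]] by simp

lemma linear_form_sum:
  assumes "\<And>k. k \<in> K \<Longrightarrow> linear_form V (F k)"
  shows "linear_form V (\<lambda>x. \<Sum>k\<in>K. F k x)"
proof -
  obtain a where "\<And>k x. k \<in> K \<Longrightarrow> F k x = (\<Sum>j\<in>V. a k j * x j)"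
    using assms unfolding linear_form_def by metis
  then have "(\<Sum>k\<in>K. F k x) = (\<Sum>j\<in>V. (\<Sum>k\<in>K. a k j) * x j)" for x
    by (simp add: sum_distrib_right sum.swap[of _ V K])
  then show ?thesis
    unfolding linear_form_def by (intro exI[of _ "\<lambda>j. \<Sum>k\<in>K. a k j"]) simp
qed

text \<open>Keeping conditions of this shape as predicates lets the constraints of a program be recognized
  by following their syntax, without ever writing down a coefficient vector.\<close>

definition linear_constraints :: "'v set \<Rightarrow> (('v \<Rightarrow> real) \<Rightarrow> bool) \<Rightarrow> bool" where
  "linear_constraints V P \<longleftrightarrow>
     (\<exists>(eqs :: (('v \<Rightarrow> real) \<times> real) set) (ineqs :: (('v \<Rightarrow> real) \<times> real) set).
        finite eqs \<and> finite ineqs \<and>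
        (\<forall>x. P x \<longleftrightarrow> (\<forall>(a, b)\<in>eqs. (\<Sum>j\<in>V. a j * x j) = b) \<and>
                      (\<forall>(a, b)\<in>ineqs. (\<Sum>j\<in>V. a j * x j) \<le> b)))"

lemma linear_constraints_eq:
  assumes "linear_form V F"
  shows "linear_constraints V (\<lambda>x. F x = b)"
proof -
  obtain a where "\<And>x. F x = (\<Sum>j\<in>V. a j * x j)"
    using assms unfolding linear_form_def by blast
  then show ?thesis
    unfolding linear_constraints_def by (intro exI[of _ "{(a, b)}"] exI[of _ "{}"]) simp
qed

lemma linear_constraints_le:
  assumes "linear_form V F"
  shows "linear_constraints V (\<lambda>x. F x \<le> b)"
proof -
  obtain a where "\<And>x. F x = (\<Sum>j\<in>V. a j * x j)"
    using assms unfolding linear_form_def by blast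
  then show ?thesis
    unfolding linear_constraints_def by (intro exI[of _ "{}"] exI[of _ "{(a, b)}"]) simp
qed

lemma linear_constraints_nonneg:
  assumes "linear_form V F"
  shows "linear_constraints V (\<lambda>x. 0 \<le> F x)"
  using linear_constraints_le[OF linear_form_scale[OF assms, of "-1"], of 0] by simp

lemma linear_constraints_conj:
  assumes "linear_constraints V P" "linear_constraints V Q"
  shows "linear_constraints V (\<lambda>x. P x \<and> Q x)"
proof -
  obtain e i where 1: "finite e" "finite i"
    "\<And>x. P x \<longleftrightarrow> (\<forall>(a, b)\<in>e. (\<Sum>j\<in>V. a j * x j) = b) \<and> (\<forall>(a, b)\<in>i. (\<Sum>j\<in>V. a j * x j) \<le> b)"
    using assms(1) unfolding linear_constraints_def by blast
  obtain e' i' where 2: "finite e'" "finite i'"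
    "\<And>x. Q x \<longleftrightarrow> (\<forall>(a, b)\<in>e'. (\<Sum>j\<in>V. a j * x j) = b) \<and> (\<forall>(a, b)\<in>i'. (\<Sum>j\<in>V. a j * x j) \<le> b)"
    using assms(2) unfolding linear_constraints_def by blast
  show ?thesis
    unfolding linear_constraints_def using 1 2
    by (intro exI[of _ "e \<union> e'"] exI[of _ "i \<union> i'"]) (auto simp: ball_Un)
qed

lemma linear_constraints_ball:
  assumes "finite K" "\<And>k. k \<in> K \<Longrightarrow> linear_constraints V (P k)"
  shows "linear_constraints V (\<lambda>x. \<forall>k\<in>K. P k x)"
  using assms
proof (induction K)
  case empty
  show ?case
    unfolding linear_constraints_def by (intro exI[of _ "{}"]) simp
next
  case (insert k K)
  then show ?case
    by (simp add: linear_constraints_conj)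
qed

lemma is_linear_programI:
  assumes "finite (variables P)"
    and "linear_form (variables P) (objective P)"
    and "linear_constraints (variables P) Q"
    and "feasible P = {x \<in> variables P \<rightarrow>\<^sub>E UNIV. Q x}"
  shows "is_linear_program P"
proof -
  obtain e i where "finite e" "finite i"
    "\<And>x. Q x \<longleftrightarrow> (\<forall>(a, b)\<in>e. (\<Sum>j\<in>variables P. a j * x j) = b) \<and>
             (\<forall>(a, b)\<in>i. (\<Sum>j\<in>variables P. a j * x j) \<le> b)"
    using assms(3) unfolding linear_constraints_def by blast
  then have "\<exists>(eqs :: (('a \<Rightarrow> real) \<times> real) set) (ineqs :: (('a \<Rightarrow> real) \<times> real) set).
        finite eqs \<and> finite ineqs \<and>
        feasible P = {x \<in> variables P \<rightarrow>\<^sub>E UNIV.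
          (\<forall>(a, b)\<in>eqs. (\<Sum>j\<in>variables P. a j * x j) = b) \<and>
          (\<forall>(a, b)\<in>ineqs. (\<Sum>j\<in>variables P. a j * x j) \<le> b)}"
    using assms(4) by (intro exI[of _ e] exI[of _ i]) simp
  then show ?thesis
    using assms(1,2) unfolding is_linear_program_def linear_form_def by blast
qed


section \<open>Extensions of a geometry and admissible weights\<close>

text \<open>In terms of extensions, the tail condition on \<open>(J, \<tau>)\<close> and the two side conditions on a
  coordinate (which is the case of a geometry on a singleton) become instances of one expression.\<close>

definition extensions :: "'n geometry \<Rightarrow> 'n geometry set" where
  "extensions = (\<lambda>(J, \<tau>). {(I, \<sigma>) \<in> geometries. J \<subseteq> I \<and> restrict \<sigma> J = \<tau>})"

definition side_geometry :: "'n \<Rightarrow> side \<Rightarrow> 'n geometry" where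
  "side_geometry i s = ({i}, \<lambda>j\<in>{i}. s)"

definition admissible_weights :: "real \<Rightarrow> ('n::finite geometry \<Rightarrow> real) set" where
  "admissible_weights p = {w \<in> geometries \<rightarrow>\<^sub>E UNIV.
     (\<forall>g\<in>geometries. 0 \<le> w g) \<and> (\<forall>i s. sum w (extensions (side_geometry i s)) = 1) \<and>
     sum w geometries \<le> 1 / p}"

lemma finite_sides: "finite (A :: side set)"
  by (rule finite_subset[of _ "{Lower, Upper}"]) (auto intro: side.exhaust)

lemma finite_geometries: "finite (geometries :: 'n::finite geometry set)"
proof -
  have "finite (\<Union>I :: 'n set. {I} \<times> (I \<rightarrow>\<^sub>E (UNIV :: side set)))"
    by (auto intro!: finite_PiE simp: finite_sides)
  then show ?thesis
    by (rule finite_subset[rotated]) (auto simp: geometries_def)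
qed

lemma extensions_subset: "extensions g \<subseteq> geometries"
  by (auto simp: extensions_def)

lemma side_geometry_in_geometries: "side_geometry i s \<in> geometries"
  by (simp add: side_geometry_def geometries_def)

lemma extensions_side_geometry:
  "extensions (side_geometry i s) = {(I, \<sigma>). (I, \<sigma>) \<in> geometries \<and> i \<in> I \<and> \<sigma> i = s}"
  by (auto simp: extensions_def side_geometry_def restrict_def fun_eq_iff)

lemma sum_extensions:
  fixes f :: "'n::finite geometry \<Rightarrow> real"
  assumes "(J, \<tau>) \<in> geometries"
  shows "(\<Sum>I | J \<subseteq> I. \<Sum>\<sigma> | \<sigma> \<in> I \<rightarrow>\<^sub>E UNIV \<and> restrict \<sigma> J = \<tau>. f (I, \<sigma>)) =
    sum f (extensions (J, \<tau>))"
proof -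
  have eq: "extensions (J, \<tau>) =
      Sigma {I. J \<subseteq> I} (\<lambda>I. {\<sigma>. \<sigma> \<in> I \<rightarrow>\<^sub>E UNIV \<and> restrict \<sigma> J = \<tau>})"
    using assms by (auto simp: extensions_def geometries_def)
  have "finite {\<sigma>. \<sigma> \<in> I \<rightarrow>\<^sub>E UNIV \<and> restrict \<sigma> J = \<tau>}" for I :: "'n set"
    by (rule finite_subset[of _ "I \<rightarrow>\<^sub>E (UNIV :: side set)"]) (auto simp: finite_PiE finite_sides)
  then show ?thesis
    unfolding eq by (subst sum.Sigma) auto
qed


section \<open>Laws of the coordinates of a component\<close>

text \<open>For \<open>I = {}\<close> all coordinates take the last branch, which is the bulk; hence
  \<open>bulk_component_eq_witness_component\<close>, and the bulk needs no treatment of its own.\<close>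

definition coordinate_map :: "real \<Rightarrow> 'n geometry \<Rightarrow> 'n \<Rightarrow> real \<Rightarrow> real" where
  "coordinate_map p g i z =
     (if i \<in> fst g then (case snd g i of Lower \<Rightarrow> p * z | Upper \<Rightarrow> 1 - p * z)
      else p + (1 - 2 * p) * z)"

lemma prob_space_uniform01: "prob_space uniform01"
  by (rule prob_space_uniform_measure) auto

lemma measurable_coordinate_map [measurable]: "coordinate_map p g i \<in> borel_measurable borel"
  unfolding coordinate_map_def [abs_def]
  by (cases "i \<in> fst g"; cases "snd g i") auto

lemma distr_pair_snd:
  assumes "prob_space M" "prob_space N"
  shows "distr (M \<Otimes>\<^sub>M N) N snd = N"
proof (rule measure_eqI)
  interpret M: prob_space M by fact
  interpret N: prob_space N by fact
  fix A assume "A \<in> sets (distr (M \<Otimes>\<^sub>M N) N snd)"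
  then have A: "A \<in> sets N" by simp
  have "snd -` A \<inter> space (M \<Otimes>\<^sub>M N) = space M \<times> A"
    using sets.sets_into_space[OF A] by (auto simp: space_pair_measure)
  then show "emeasure (distr (M \<Otimes>\<^sub>M N) N snd) A = emeasure N A"
    using A by (simp add: emeasure_distr N.emeasure_pair_measure_Times M.emeasure_space_1)
qed simp

text \<open>The Borel sets of \<open>real ^ 'n\<close> are generated by the coordinates, because the basis vectors are the
  unit vectors of the axes.\<close>

lemma borel_measurable_vec_lambda:
  assumes "\<And>i :: 'n::finite. (\<lambda>x. f x i) \<in> borel_measurable M"
  shows "(\<lambda>x. \<chi> i. f x i) \<in> M \<rightarrow>\<^sub>M (borel :: (real ^ 'n) measure)"
proof (subst borel_measurable_euclidean_space, intro ballI)
  fix b :: "real ^ 'n" assume "b \<in> Basis"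
  then obtain i where "b = axis i 1"
    by (auto simp: Basis_vec_def)
  then show "(\<lambda>x. (\<chi> i. f x i) \<bullet> b) \<in> borel_measurable M"
    using assms[of i] by (simp add: inner_axis)
qed

lemma witness_component_eq_distr:
  "witness_component p g = distr (uniform01 \<Otimes>\<^sub>M (\<Pi>\<^sub>M i\<in>UNIV. uniform01)) borel
     (\<lambda>(z, V). \<chi> i. coordinate_map p g i (if i \<in> fst g then z else V i))"
  unfolding witness_component_def coordinate_map_def
  by (cases g) (auto intro!: arg_cong[where f = "distr _ _"] simp: fun_eq_iff vec_eq_iff)

lemma measurable_witness_map:
  "(\<lambda>(z, V). \<chi> i. coordinate_map p g i (if i \<in> fst g then z else V i))
     \<in> uniform01 \<Otimes>\<^sub>M (\<Pi>\<^sub>M i\<in>UNIV. uniform01) \<rightarrow>\<^sub>M (borel :: (real ^ 'n::finite) measure)"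
proof -
  have "(\<lambda>x. coordinate_map p g i (if i \<in> fst g then fst x else snd x i))
      \<in> borel_measurable (uniform01 \<Otimes>\<^sub>M (\<Pi>\<^sub>M i\<in>UNIV. uniform01))" for i :: 'n
    by measurable
  from borel_measurable_vec_lambda[OF this] show ?thesis
    by (simp add: split_beta')
qed

lemma prob_space_uniform_pair:
  "prob_space (uniform01 \<Otimes>\<^sub>M (\<Pi>\<^sub>M i\<in>(UNIV :: 'n set). uniform01))"
  by (intro prob_space_pair prob_space_PiM prob_space_uniform01)

lemma prob_space_witness_component: "prob_space (witness_component p g)"
  unfolding witness_component_eq_distr
  by (rule prob_space.prob_space_distr[OF prob_space_uniform_pair measurable_witness_map])

lemma sets_witness_component: "sets (witness_component p g) = sets borel"
  by (simp add: witness_component_def split: prod.split)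

lemma bulk_component_eq_witness_component:
  "bulk_component p = witness_component p ({}, \<sigma> :: 'n::finite \<Rightarrow> side)"
proof -
  let ?N = "\<Pi>\<^sub>M i\<in>(UNIV :: 'n set). uniform01"
  let ?f = "\<lambda>V :: 'n \<Rightarrow> real. \<chi> i. p + (1 - 2 * p) * V i"
  have f: "?f \<in> borel_measurable ?N"
    by (rule borel_measurable_vec_lambda) measurable
  have "bulk_component p = distr (distr (uniform01 \<Otimes>\<^sub>M ?N) ?N snd) borel ?f"
    by (simp add: bulk_component_def distr_pair_snd prob_space_uniform01 prob_space_PiM)
  also have "\<dots> = witness_component p ({}, \<sigma>)"
    by (subst distr_distr[OF f]) (auto simp: witness_component_def comp_def split_beta')
  finally show ?thesis .
qed

text \<open>Every coordinate is an affine image of a single uniform variable, namely \<open>Z\<close> or its own \<open>V\<^sub>i\<close>.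
  Both the margins and, up to null sets, the tail events of a component are governed by these laws.\<close>

lemma distr_witness_component:
  "distr (witness_component p g) borel (\<lambda>u. u $ i) = distr uniform01 borel (coordinate_map p g i)"
proof -
  let ?N = "\<Pi>\<^sub>M i\<in>(UNIV :: 'a set). uniform01"
  let ?D = "uniform01 \<Otimes>\<^sub>M ?N"
  have "distr (witness_component p g) borel (\<lambda>u. u $ i) =
      distr ?D borel (\<lambda>x. coordinate_map p g i (if i \<in> fst g then fst x else snd x i))"
    unfolding witness_component_eq_distr
    by (subst distr_distr[OF _ measurable_witness_map]) (auto simp: comp_def split_beta')
  also have "\<dots> = distr (distr ?D uniform01 (\<lambda>x. if i \<in> fst g then fst x else snd x i))
      borel (coordinate_map p g i)"
    by (subst distr_distr) (auto simp: comp_def)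
  also have "distr ?D uniform01 (\<lambda>x. if i \<in> fst g then fst x else snd x i) = uniform01"
  proof (cases "i \<in> fst g")
    case True
    then show ?thesis
      using prob_space.distr_pair_fst[OF prob_space_PiM[OF prob_space_uniform01]] by simp
  next
    case False
    have "distr ?D uniform01 (\<lambda>x. snd x i) = distr (distr ?D ?N snd) uniform01 (\<lambda>V. V i)"
      by (subst distr_distr) (auto simp: comp_def)
    also have "\<dots> = uniform01"
      using distr_PiM_component[of UNIV "\<lambda>_ :: 'a. uniform01" i]
      by (simp add: distr_pair_snd prob_space_uniform01 prob_space_PiM)
    finally show ?thesis
      using False by simp
  qed
  finally show ?thesis .
qed

lemma AE_uniform01: "AE z in uniform01. 0 < z \<and> z < 1"
proof (rule AE_uniform_measureI)
  show "AE z in lborel. z \<in> {0..1} \<longrightarrow> 0 < z \<and> z < (1::real)"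
    using AE_lborel_singleton[of 0] AE_lborel_singleton[of 1] by eventually_elim auto
qed simp

text \<open>Outside the null event that \<open>Z\<close> or some \<open>V\<^sub>i\<close> is an endpoint of \<open>[0, 1]\<close>, the affine maps send each
  coordinate into the interior of its own interval, so that it cannot touch another one.\<close>

lemma AE_witness_component_tails:
  assumes "0 < p" "p < 1 / 2"
  shows "AE u in witness_component p g. \<forall>i.
    (u $ i \<le> p \<longleftrightarrow> i \<in> fst g \<and> snd g i = Lower) \<and> (1 - p \<le> u $ i \<longleftrightarrow> i \<in> fst g \<and> snd g i = Upper)"
proof (intro eventually_all_finite)
  fix i
  let ?P = "\<lambda>t. (t \<le> p \<longleftrightarrow> i \<in> fst g \<and> snd g i = Lower) \<and>
    (1 - p \<le> t \<longleftrightarrow> i \<in> fst g \<and> snd g i = Upper)"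
  have range: "?P (coordinate_map p g i z)" if "0 < z" "z < 1" for z
  proof -
    define a b where "a = p * z" and "b = (1 - 2 * p) * z"
    have "0 < a" "a < p" "0 < b" "b < 1 - 2 * p"
      using assms that by (simp_all add: a_def b_def)
    then show ?thesis
      using assms by (auto simp: coordinate_map_def simp flip: a_def b_def split: side.split)
  qed
  have "AE z in uniform01. ?P (coordinate_map p g i z)"
    using AE_uniform01 by eventually_elim (use range in blast)
  then have "AE t in distr uniform01 borel (coordinate_map p g i). ?P t"
    by (subst AE_distr_iff) auto
  then have "AE t in distr (witness_component p g) borel (\<lambda>u. u $ i). ?P t"
    unfolding distr_witness_component .
  then show "AE u in witness_component p g. ?P (u $ i)"
    by (rule AE_distrD[rotated]) (simp add: measurable_cong_sets[OF sets_witness_component refl])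
qed

definition tail_event :: "real \<Rightarrow> 'n geometry \<Rightarrow> (real ^ 'n) set" where
  "tail_event p = (\<lambda>(J, \<tau>).
     {u. (\<forall>i\<in>J. \<tau> i = Lower \<longrightarrow> u $ i \<le> p) \<and> (\<forall>i\<in>J. \<tau> i = Upper \<longrightarrow> u $ i \<ge> 1 - p)})"

lemma tail_event_borel: "tail_event p g \<in> sets (borel :: (real ^ 'n::finite) measure)"
proof -
  have "tail_event p g = (\<Inter>i\<in>fst g. (if snd g i = Lower then {u. u $ i \<le> p} else UNIV) \<inter>
      (if snd g i = Upper then {u. 1 - p \<le> u $ i} else UNIV))"
    unfolding tail_event_def by (cases g) (auto split: if_splits)
  moreover have "closed \<dots>"
    by (auto intro!: closed_INT closed_Int closed_Collect_le continuous_intros)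
  ultimately show ?thesis
    by (simp add: borel_closed)
qed

text \<open>By \<open>AE_witness_component_tails\<close> the event is almost surely a fact about the geometries alone.\<close>

lemma measure_witness_component_tail_event:
  assumes p: "0 < p" "p < 1 / 2" and g: "g \<in> geometries"
  shows "measure (witness_component p h) (tail_event p g) =
    of_bool (fst g \<subseteq> fst h \<and> restrict (snd h) (fst g) = snd g)"
proof -
  interpret prob_space "witness_component p h" by (rule prob_space_witness_component)
  have ext: "restrict (snd h) (fst g) = snd g \<longleftrightarrow> (\<forall>i\<in>fst g. snd h i = snd g i)"
    using g by (auto simp: geometries_def restrict_def fun_eq_iff PiE_def extensional_def)
  have *: "AE u in witness_component p h. u \<in> tail_event p g \<longleftrightarrow>
      fst g \<subseteq> fst h \<and> restrict (snd h) (fst g) = snd g"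
    using AE_witness_component_tails[OF p, of h]
  proof eventually_elim
    case (elim u)
    then show ?case
      unfolding ext tail_event_def
      by (cases g) (auto, (metis side.exhaust)+)
  qed
  show ?thesis
  proof (cases "fst g \<subseteq> fst h \<and> restrict (snd h) (fst g) = snd g")
    case True
    then show ?thesis
      using * prob_eq_1[of "tail_event p g"] by (simp add: sets_witness_component tail_event_borel)
  next
    case False
    then show ?thesis
      using * prob_eq_0[of "tail_event p g"] by (auto simp: sets_witness_component tail_event_borel)
  qed
qed

section \<open>The witness measure\<close>

lemma measure_witness_measure:
  assumes "0 \<le> p" "\<forall>g\<in>geometries. 0 \<le> v g" "0 \<le> bulk_mass p v" "A \<in> sets borel"
  shows "measure (witness_measure p v) A = bulk_mass p v * measure (bulk_component p) A +
    p * (\<Sum>g\<in>geometries. v g * measure (witness_component p g) A)"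
proof -
  interpret W: prob_space "witness_component p g" for g :: "'a geometry"
    by (rule prob_space_witness_component)
  have "ennreal (p * v g) * emeasure (witness_component p g) A =
      ennreal (p * v g * measure (witness_component p g) A)" if "g \<in> geometries" for g
    using assms that by (simp add: W.emeasure_eq_measure ennreal_mult'')
  then have "emeasure (witness_measure p v) A =
      ennreal (bulk_mass p v * measure (bulk_component p) A) +
      (\<Sum>g\<in>geometries. ennreal (p * v g * measure (witness_component p g) A))"
    using assms
    by (simp add: emeasure_witness_measure bulk_component_eq_witness_component[of p undefined]
        W.emeasure_eq_measure ennreal_mult'')
  also have "\<dots> = ennreal (bulk_mass p v * measure (bulk_component p) A +
      (\<Sum>g\<in>geometries. p * v g * measure (witness_component p g) A))"
    using assms by (subst sum_ennreal) (auto intro!: sum_nonneg ennreal_plus[symmetric])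
  finally have "emeasure (witness_measure p v) A = \<dots>" .
  moreover have "0 \<le> bulk_mass p v * measure (bulk_component p) A +
      (\<Sum>g\<in>geometries. p * v g * measure (witness_component p g) A)"
    using assms by (intro add_nonneg_nonneg mult_nonneg_nonneg sum_nonneg) auto
  ultimately have "measure (witness_measure p v) A = bulk_mass p v * measure (bulk_component p) A +
      (\<Sum>g\<in>geometries. p * v g * measure (witness_component p g) A)"
    by (simp only: measure_def[of "witness_measure p v"] enn2real_ennreal)
  then show ?thesis
    by (simp add: sum_distrib_left mult.assoc)
qed

lemma prob_space_witness_measure:
  assumes "0 \<le> p" "\<forall>g\<in>geometries. 0 \<le> v g" "0 \<le> bulk_mass p v"
  shows "prob_space (witness_measure p v :: (real ^ 'n::finite) measure)"
proof (rule prob_spaceI)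
  have "emeasure (witness_component p g) UNIV = 1" for g :: "'n geometry"
    using prob_space.emeasure_space_1[OF prob_space_witness_component[of p g]]
      sets_eq_imp_space_eq[OF sets_witness_component[of p g]] by simp
  then have "emeasure (witness_measure p v :: (real ^ 'n) measure) UNIV =
      ennreal (bulk_mass p v) + (\<Sum>g\<in>geometries. ennreal (p * v g))"
    by (simp add: emeasure_witness_measure bulk_component_eq_witness_component[of p undefined])
  also have "\<dots> = ennreal (bulk_mass p v + (\<Sum>g\<in>geometries. p * v g))"
    using assms by (simp add: sum_nonneg)
  also have "\<dots> = 1"
    by (simp add: bulk_mass_def sum_distrib_left)
  finally show "emeasure (witness_measure p v) (space (witness_measure p v :: (real ^ 'n) measure)) = 1"
    using sets_eq_imp_space_eq[OF sets_witness_measure[of p v]] by simp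
qed

text \<open>Of the components, exactly the extensions of \<open>g\<close> charge the event, and they charge it fully.\<close>

lemma measure_witness_measure_tail_event:
  assumes p: "0 < p" "p < 1 / 2" and v: "\<forall>h\<in>geometries. 0 \<le> v h" "0 \<le> bulk_mass p v"
    and g: "g \<in> geometries"
  shows "measure (witness_measure p v) (tail_event p g) = p * sum v (extensions g)"
proof -
  have "extensions g = {h \<in> geometries. fst g \<subseteq> fst h \<and> restrict (snd h) (fst g) = snd g}"
    by (auto simp: extensions_def split_beta')
  then have "sum v (extensions g) =
      (\<Sum>h\<in>geometries. v h * of_bool (fst g \<subseteq> fst h \<and> restrict (snd h) (fst g) = snd g))"
    by (simp add: of_bool_def if_distrib sum.inter_filter finite_geometries cong: if_cong)
  moreover have "fst g \<noteq> {}"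
    using g by (auto simp: geometries_def)
  ultimately show ?thesis
    using p v g by (simp add: measure_witness_measure tail_event_borel
        bulk_component_eq_witness_component[of p undefined]
        measure_witness_component_tail_event)
qed

lemma tail_coefficient_witness_measure:
  assumes "0 < p" "p < 1 / 2" "\<forall>h\<in>geometries. 0 \<le> v h" "0 \<le> bulk_mass p v" "g \<in> geometries"
  shows "tail_coefficient p (joint_cdf (witness_measure p v)) g = sum v (extensions g)"
proof -
  have "tail_coefficient p (joint_cdf (witness_measure p v)) g =
      1 / p * measure (witness_measure p v) (tail_event p g)"
    using assms by (simp add: tail_coefficient_def tail_event_def law_of_joint_cdf
        prob_space_witness_measure sets_witness_measure split_beta')
  then show ?thesis
    using assms measure_witness_measure_tail_event[of p v g] by simp
qed

text \<open>The two pieces share the point \<open>b\<close>, which is Lebesgue null.\<close>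

lemma measure_lborel_split:
  fixes A :: "real set"
  assumes A: "A \<in> sets borel" and "a \<le> b" "b \<le> c"
  shows "measure lborel (A \<inter> {a..c}) = measure lborel (A \<inter> {a..b}) + measure lborel (A \<inter> {b..c})"
proof -
  have fin: "emeasure lborel (A \<inter> {s..t}) \<noteq> \<infinity>" for s t
    using emeasure_mono[of "A \<inter> {s..t}" "{s..t}" lborel]
    by (auto simp: top_unique emeasure_lborel_Icc_eq split: if_splits)
  have "emeasure lborel (A \<inter> {a..c}) = emeasure lborel (A \<inter> {a..b}) + emeasure lborel (A \<inter> {b..c})"
  proof (rule emeasure_add_AE)
    show "AE x in lborel. \<not> (x \<in> A \<inter> {a..b} \<and> x \<in> A \<inter> {b..c})"
      using AE_lborel_singleton[of b] by eventually_elim auto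
    show "AE x in lborel. x \<in> A \<inter> {a..c} \<longleftrightarrow> x \<in> A \<inter> {a..b} \<or> x \<in> A \<inter> {b..c}"
      using assms by (intro AE_I2) auto
  qed (use A in auto)
  then show ?thesis
    using fin unfolding measure_def by (simp add: enn2real_plus top.not_eq_extremum)
qed

text \<open>The law is uniform on the image interval, of length \<open>\<bar>c\<bar>\<close>. Without the division by the length,
  the laws on adjacent intervals add up by \<open>measure_lborel_split\<close>.\<close>

lemma measure_distr_uniform01_affine:
  fixes A :: "real set"
  assumes A: "A \<in> sets borel" and c: "c \<noteq> 0"
  shows "\<bar>c\<bar> * measure (distr uniform01 borel (\<lambda>z. t + c * z)) A =
    measure lborel (A \<inter> (\<lambda>z. t + c * z) ` {0..1})"
proof -
  let ?f = "\<lambda>z. t + c * z"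
  have vimage: "?f -` (A \<inter> ?f ` {0..1}) = {0..1} \<inter> ?f -` A"
    using c by auto
  have "compact (?f ` {0..1})"
    by (intro compact_continuous_image continuous_intros) auto
  then have B: "A \<inter> ?f ` {0..1} \<in> sets borel"
    using A borel_closed[OF compact_imp_closed] by blast
  have "emeasure lborel (A \<inter> ?f ` {0..1}) = ennreal \<bar>c\<bar> * emeasure lborel ({0..1} \<inter> ?f -` A)"
    using B by (subst lborel_real_affine[OF c, of t])
      (simp add: emeasure_density_const emeasure_distr vimage del: vimage_Int)
  then have "measure lborel (A \<inter> ?f ` {0..1}) = \<bar>c\<bar> * measure lborel ({0..1} \<inter> ?f -` A)"
    by (simp add: measure_def enn2real_mult)
  moreover have "?f -` A \<in> sets borel"
    using measurable_sets[of ?f borel borel A] A by simp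
  moreover have "emeasure (distr uniform01 borel ?f) A = emeasure lborel ({0..1} \<inter> ?f -` A)"
    using A calculation(2) by (simp add: emeasure_distr divide_ennreal_def)
  ultimately show ?thesis
    by (simp add: measure_def)
qed

text \<open>The tail events of singletons read the side sums off uniform margins. Conversely, each component
  contributes to the \<open>i\<close>-th margin one of the uniform laws on \<open>[0, p]\<close>,
  \<open>[p, 1 - p]\<close>, \<open>[1 - p, 1]\<close>. The side equations say that their masses are \<open>p\<close>, \<open>1 - 2 p\<close>, \<open>p\<close>,
  which is how the uniform law on \<open>[0, 1]\<close> distributes its mass over these intervals.\<close>

lemma uniform_margins_witness_measure_iff:
  fixes v :: "'n::finite geometry \<Rightarrow> real"
  assumes p: "0 < p" "p < 1 / 2" and v: "\<forall>g\<in>geometries. 0 \<le> v g" "0 \<le> bulk_mass p v"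
  shows "uniform_margins (witness_measure p v) \<longleftrightarrow>
    (\<forall>i s. sum v (extensions (side_geometry i s)) = 1)"
proof
  assume margins: "uniform_margins (witness_measure p v)"
  show "\<forall>i s. sum v (extensions (side_geometry i s)) = 1"
  proof (intro allI)
    fix i :: 'n and s
    let ?T = "case s of Lower \<Rightarrow> {..p} | Upper \<Rightarrow> {1 - p..}"
    have "p * sum v (extensions (side_geometry i s)) =
        measure (witness_measure p v) (tail_event p (side_geometry i s))"
      using measure_witness_measure_tail_event[OF p v side_geometry_in_geometries] by simp
    also have "tail_event p (side_geometry i s) = (\<lambda>u. u $ i) -` ?T"
      by (cases s) (auto simp: tail_event_def side_geometry_def)
    also have "measure (witness_measure p v) \<dots> = measure (distr (witness_measure p v) borel (\<lambda>u. u $ i)) ?T"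
      by (cases s) (simp_all add: measure_distr measurable_cong_sets[OF sets_witness_measure refl]
          sets_eq_imp_space_eq[OF sets_witness_measure])
    also have "\<dots> = measure uniform01 ?T"
      using margins by (simp add: uniform_margins_def)
    also have "\<dots> = p"
    proof (cases s)
      case Lower
      moreover have "{0..1} \<inter> {..p} = {0..p}"
        using p by auto
      ultimately show ?thesis
        using p by simp
    next
      case Upper
      moreover have "{0..1} \<inter> {1 - p..} = {1 - p..1}"
        using p by auto
      ultimately show ?thesis
        using p by simp
    qed
    finally show "sum v (extensions (side_geometry i s)) = 1"
      using p by simp
  qed
next
  assume sides: "\<forall>i s. sum v (extensions (side_geometry i s)) = 1"
  interpret M: prob_space "witness_measure p v"
    using p v by (intro prob_space_witness_measure) auto
  show "uniform_margins (witness_measure p v)"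
    unfolding uniform_margins_def
  proof (intro allI measure_eqI)
    fix i :: 'n and A :: "real set"
    assume "A \<in> sets (distr (witness_measure p v) borel (\<lambda>u. u $ i))"
    then have A: "A \<in> sets borel" by simp
    let ?law = "\<lambda>t c. measure (distr uniform01 borel (\<lambda>z :: real. t + c * z)) A"
    define l u b where "l = ?law 0 p" and "u = ?law 1 (- p)" and "b = ?law p (1 - 2 * p)"
    let ?L = "extensions (side_geometry i Lower)" and ?U = "extensions (side_geometry i Upper)"
    have vimage: "(\<lambda>u :: real ^ 'n. u $ i) -` A \<in> sets borel"
      using measurable_sets[of "\<lambda>u :: real ^ 'n. u $ i" borel borel A] A by simp
    have component: "measure (witness_component p g) ((\<lambda>u. u $ i) -` A) =
        measure (distr uniform01 borel (coordinate_map p g i)) A" for g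
      using A unfolding distr_witness_component[symmetric]
      by (simp add: measure_distr measurable_cong_sets[OF sets_witness_component refl]
          sets_eq_imp_space_eq[OF sets_witness_component])
    \<comment> \<open>The middle law \<open>b\<close> is the default, corrected on the extensions of either side; summing against
      \<open>v\<close> then involves only the total weight and the two side sums.\<close>
    have law: "measure (distr uniform01 borel (coordinate_map p g i)) A =
        b + (if g \<in> ?L then l - b else 0) + (if g \<in> ?U then u - b else 0)"
      if "g \<in> geometries" for g
      using that
      by (cases g; cases "snd g i")
        (auto simp: extensions_side_geometry coordinate_map_def [abs_def] l_def u_def b_def)
    have bulk_law: "measure (distr uniform01 borel (coordinate_map p ({}, undefined) i)) A = b"
      by (simp add: coordinate_map_def [abs_def] b_def)
    have restrict: "(\<Sum>g\<in>geometries. v g * (if g \<in> extensions h then c else 0)) =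
        c * sum v (extensions h)" for h c
    proof -
      have "(\<Sum>g\<in>geometries. v g * (if g \<in> extensions h then c else 0)) =
          (\<Sum>g\<in>extensions h. v g * c)"
        using extensions_subset[of h] by (intro sum.mono_neutral_cong_right finite_geometries) auto
      then show ?thesis
        by (simp add: sum_distrib_left mult.commute)
    qed
    have "(\<Sum>g\<in>geometries. v g * measure (witness_component p g) ((\<lambda>u. u $ i) -` A)) =
        (\<Sum>g\<in>geometries. b * v g + v g * (if g \<in> ?L then l - b else 0) +
          v g * (if g \<in> ?U then u - b else 0))"
      by (intro sum.cong refl) (simp add: component law algebra_simps)
    also have "\<dots> = b * sum v geometries + (l - b) + (u - b)"
      using sides by (simp add: sum.distrib restrict sum_distrib_left)
    finally have "measure (witness_measure p v) ((\<lambda>u. u $ i) -` A) =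
        bulk_mass p v * b + p * (b * sum v geometries + (l - b) + (u - b))"
      using p v vimage
      by (simp add: measure_witness_measure bulk_component_eq_witness_component[of p undefined]
          component bulk_law)
    \<comment> \<open>The total weight cancels against the bulk mass.\<close>
    also have "\<dots> = p * l + (1 - 2 * p) * b + p * u"
      by (simp add: bulk_mass_def algebra_simps)
    also have "p * l = measure lborel (A \<inter> {0..p})"
      using measure_distr_uniform01_affine[OF A, of p 0] p
      by (simp add: l_def image_mult_atLeastAtMost)
    also have "(1 - 2 * p) * b = measure lborel (A \<inter> {p..1 - p})"
      using measure_distr_uniform01_affine[OF A, of "1 - 2 * p" p] p
      by (simp add: b_def add.commute[of p] image_affinity_atLeastAtMost)
    also have "p * u = measure lborel (A \<inter> {1 - p..1})"
      using measure_distr_uniform01_affine[OF A, of "- p" 1] p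
        image_affinity_atLeastAtMost[of "- p" 1 0 1]
      by (simp add: u_def)
    also have "measure lborel (A \<inter> {0..p}) + measure lborel (A \<inter> {p..1 - p}) +
        measure lborel (A \<inter> {1 - p..1}) = measure lborel (A \<inter> {0..1})"
      using measure_lborel_split[OF A, of 0 p "1 - p"] measure_lborel_split[OF A, of 0 "1 - p" 1] p
      by simp
    also have "\<dots> = measure uniform01 A"
      using A by (simp add: Int_commute)
    finally show "emeasure (distr (witness_measure p v) borel (\<lambda>u. u $ i)) A = emeasure uniform01 A"
      using A finite_measure.emeasure_eq_measure[OF prob_space.finite_measure[OF prob_space_uniform01]]
      by (simp add: emeasure_distr M.emeasure_eq_measure sets_eq_imp_space_eq[OF sets_witness_measure]
          measurable_cong_sets[OF sets_witness_measure refl])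
  qed simp
qed

text \<open>Admissible weights are extensional on the geometries, whereas the weight system of a geometric
  witness copula is an arbitrary function; this lemma passes from the second to the first.\<close>

lemma witness_measure_restrict:
  "witness_measure p (restrict v geometries) = witness_measure p v"
  unfolding witness_measure_def bulk_mass_def by (simp cong: sum.cong)

lemma sum_restrict_extensions:
  "sum (restrict v geometries) (extensions g) = sum v (extensions g)"
  using extensions_subset[of g] by (intro sum.cong) auto

lemma exactly_realizable_iff:
  fixes S :: "'n::finite geometry set"
  assumes p: "0 < p" "p < 1 / 2" and S: "S \<subseteq> geometries"
  shows "exactly_realizable p S target \<longleftrightarrow>
    (\<exists>w\<in>admissible_weights p. \<forall>g\<in>S. sum w (extensions g) = target g)"
proof
  assume "exactly_realizable p S target"
  then obtain v where v: "\<forall>g\<in>geometries. 0 \<le> v g" "0 \<le> bulk_mass p v"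
      "uniform_margins (witness_measure p v)"
    and target: "\<forall>g\<in>S. tail_coefficient p (joint_cdf (witness_measure p v)) g = target g"
    unfolding exactly_realizable_def geometric_witness_copula_def by auto
  have "restrict v geometries \<in> admissible_weights p"
    using p v uniform_margins_witness_measure_iff[OF p v(1,2)]
    unfolding admissible_weights_def mem_Collect_eq sum_restrict_extensions
    by (auto simp: bulk_mass_def field_simps)
  moreover have "sum (restrict v geometries) (extensions g) = target g" if "g \<in> S" for g
    using that S target tail_coefficient_witness_measure[OF p v(1,2), of g]
    unfolding sum_restrict_extensions by auto
  ultimately show "\<exists>w\<in>admissible_weights p. \<forall>g\<in>S. sum w (extensions g) = target g"
    by blast
next
  assume "\<exists>w\<in>admissible_weights p. \<forall>g\<in>S. sum w (extensions g) = target g"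
  then obtain w where w: "w \<in> admissible_weights p"
    and target: "\<forall>g\<in>S. sum w (extensions g) = target g"
    by blast
  have nonneg: "\<forall>g\<in>geometries. 0 \<le> w g" "0 \<le> bulk_mass p w"
    using w p by (simp_all add: admissible_weights_def bulk_mass_def field_simps)
  then have "uniform_margins (witness_measure p w)"
    using w uniform_margins_witness_measure_iff[OF p nonneg] by (simp add: admissible_weights_def)
  moreover have "tail_coefficient p (joint_cdf (witness_measure p w)) g = target g" if "g \<in> S" for g
    using that S target tail_coefficient_witness_measure[OF p nonneg, of g] by auto
  ultimately show "exactly_realizable p S target"
    unfolding exactly_realizable_def geometric_witness_copula_def using nonneg by blast
qed

section \<open>Compactness of the admissible weights\<close>

text \<open>In the product topology on the full function space, the extensional functions on \<open>K\<close> are those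
  with the single value \<open>undefined\<close> off \<open>K\<close>, so that they form a product of compact sets and
  Tychonoff's theorem applies.\<close>

lemma compact_PiE_const:
  fixes B :: "'b::topological_space set"
  assumes "compact B"
  shows "compact (K \<rightarrow>\<^sub>E B)"
proof -
  have "K \<rightarrow>\<^sub>E B = PiE UNIV (\<lambda>k. if k \<in> K then B else {undefined})"
    by (auto simp: PiE_def Pi_def extensional_def split: if_splits)
  moreover have "compactin (product_topology (\<lambda>_. euclidean) UNIV)
      (PiE UNIV (\<lambda>k. if k \<in> K then B else {undefined}))"
    unfolding compactin_PiE using assms by auto
  ultimately show ?thesis
    by (simp add: euclidean_product_topology)
qed

lemma continuous_on_sum_coordinates:
  "continuous_on A (\<lambda>w :: 'a \<Rightarrow> real. sum w K)"
  by (intro continuous_on_sum continuous_on_subset[OF continuous_on_product_coordinates]) simp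

text \<open>Nonnegative weights are bounded by their total, hence by \<open>1 / p\<close>, and the other constraints are
  closed conditions.\<close>

lemma compact_admissible_weights: "compact (admissible_weights p :: ('n::finite geometry \<Rightarrow> real) set)"
proof -
  let ?G = "geometries :: 'n geometry set"
  let ?C = "{w. (\<forall>i s. sum w (extensions (side_geometry i s)) = 1) \<and> sum w ?G \<le> 1 / p}"
  have "w g \<le> 1 / p" if "\<forall>h\<in>?G. 0 \<le> w h" "sum w ?G \<le> 1 / p" "g \<in> ?G" for w g
    using that member_le_sum[of g ?G w] finite_geometries by fastforce
  then have "admissible_weights p = (?G \<rightarrow>\<^sub>E {0..1 / p}) \<inter> ?C"
    unfolding admissible_weights_def by (auto simp: PiE_def)
  moreover have "closed ?C"
    by (intro closed_Collect_conj closed_Collect_all closed_Collect_eq closed_Collect_le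
        continuous_on_sum_coordinates continuous_on_const)
  moreover have "compact (?G \<rightarrow>\<^sub>E {0..1 / p})"
    by (rule compact_PiE_const) simp
  ultimately show ?thesis
    by (simp add: compact_Int_closed)
qed

section \<open>Eliminating the residuals\<close>

definition weights_of :: "('n calibration_var \<Rightarrow> real) \<Rightarrow> 'n geometry \<Rightarrow> real" where
  "weights_of x = (\<lambda>g\<in>geometries. x (Weight g))"

lemma variables_calibration_problem:
  "variables (calibration_problem p S target \<omega>) =
     Weight ` geometries \<union> ResidualPos ` S \<union> ResidualNeg ` S"
  by (simp add: calibration_problem_def Let_def)

lemma objective_calibration_problem:
  "objective (calibration_problem p S target \<omega>) x =
     (\<Sum>g\<in>S. \<omega> g * (x (ResidualPos g) + x (ResidualNeg g)))"
  by (simp add: calibration_problem_def Let_def)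

text \<open>The constraints in terms of extensions, with all variables on the left-hand sides as a linear
  program requires.\<close>

lemma feasible_calibration_problem:
  assumes "S \<subseteq> geometries"
  shows "feasible (calibration_problem p S target \<omega>) =
    {x \<in> variables (calibration_problem p S target \<omega>) \<rightarrow>\<^sub>E UNIV.
       (\<forall>g\<in>geometries. 0 \<le> x (Weight g)) \<and>
       (\<forall>g\<in>S. 0 \<le> x (ResidualPos g) \<and> 0 \<le> x (ResidualNeg g) \<and>
          (\<Sum>h\<in>extensions g. x (Weight h)) - (x (ResidualPos g) - x (ResidualNeg g)) = target g) \<and>
       (\<forall>i\<in>UNIV. \<forall>s\<in>UNIV. (\<Sum>h\<in>extensions (side_geometry i s). x (Weight h)) = 1) \<and>
       (\<Sum>g\<in>geometries. x (Weight g)) \<le> 1 / p}"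
proof -
  have residual: "(\<forall>(J, \<tau>)\<in>S. 0 \<le> x (ResidualPos (J, \<tau>)) \<and> 0 \<le> x (ResidualNeg (J, \<tau>)) \<and>
        (\<Sum>I | J \<subseteq> I. \<Sum>\<sigma> | \<sigma> \<in> I \<rightarrow>\<^sub>E UNIV \<and> restrict \<sigma> J = \<tau>. x (Weight (I, \<sigma>))) - target (J, \<tau>)
          = x (ResidualPos (J, \<tau>)) - x (ResidualNeg (J, \<tau>))) \<longleftrightarrow>
      (\<forall>g\<in>S. 0 \<le> x (ResidualPos g) \<and> 0 \<le> x (ResidualNeg g) \<and>
        (\<Sum>h\<in>extensions g. x (Weight h)) - (x (ResidualPos g) - x (ResidualNeg g)) = target g)"
    for x :: "'a calibration_var \<Rightarrow> real"
    using sum_extensions[of _ _ "\<lambda>h. x (Weight h)"] assms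
    by (intro ball_cong refl) (auto simp: algebra_simps)
  have sides: "(\<forall>i. (\<Sum>(I, \<sigma>) | (I, \<sigma>) \<in> geometries \<and> i \<in> I \<and> \<sigma> i = Lower. x (Weight (I, \<sigma>))) = 1) \<and>
      (\<forall>i. (\<Sum>(I, \<sigma>) | (I, \<sigma>) \<in> geometries \<and> i \<in> I \<and> \<sigma> i = Upper. x (Weight (I, \<sigma>))) = 1) \<longleftrightarrow>
      (\<forall>i\<in>UNIV. \<forall>s\<in>UNIV. (\<Sum>h\<in>extensions (side_geometry i s). x (Weight h)) = 1)"
    for x :: "'a calibration_var \<Rightarrow> real"
  proof -
    have "(\<forall>s\<in>UNIV. P s) \<longleftrightarrow> P Lower \<and> P Upper" for P
      by (metis UNIV_I side.exhaust)
    then show ?thesis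
      unfolding extensions_side_geometry by (simp add: all_conj_distrib)
  qed
  show ?thesis
    unfolding calibration_problem_def Let_def minimization_problem.simps residual
    by (simp only: sides[symmetric] conj_assoc)
qed

lemma is_linear_program_calibration_problem:
  assumes S: "S \<subseteq> geometries"
  shows "is_linear_program (calibration_problem p S target \<omega>)"
proof (rule is_linear_programI[OF _ _ _ feasible_calibration_problem[OF S]])
  let ?V = "variables (calibration_problem p S target \<omega>)"
  have "finite S"
    using S finite_geometries by (rule finite_subset)
  then show fin: "finite ?V"
    by (simp add: variables_calibration_problem finite_geometries)
  have weight: "linear_form ?V (\<lambda>x. x (Weight g))" if "g \<in> geometries" for g
    using fin that by (intro linear_form_variable) (auto simp: variables_calibration_problem)
  have residual: "linear_form ?V (\<lambda>x. x (ResidualPos g))" "linear_form ?V (\<lambda>x. x (ResidualNeg g))"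
    if "g \<in> S" for g
    using fin that by (auto intro!: linear_form_variable simp: variables_calibration_problem)
  have extension: "linear_form ?V (\<lambda>x. \<Sum>h\<in>extensions g. x (Weight h))" for g
    using extensions_subset[of g] by (intro linear_form_sum weight) auto
  show "linear_form ?V (objective (calibration_problem p S target \<omega>))"
    unfolding objective_calibration_problem [abs_def]
    by (intro linear_form_sum linear_form_scale linear_form_add residual)
  show "linear_constraints ?V (\<lambda>x.
       (\<forall>g\<in>geometries. 0 \<le> x (Weight g)) \<and>
       (\<forall>g\<in>S. 0 \<le> x (ResidualPos g) \<and> 0 \<le> x (ResidualNeg g) \<and>
          (\<Sum>h\<in>extensions g. x (Weight h)) - (x (ResidualPos g) - x (ResidualNeg g)) = target g) \<and>
       (\<forall>i\<in>UNIV. \<forall>s\<in>UNIV. (\<Sum>h\<in>extensions (side_geometry i s). x (Weight h)) = 1) \<and>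
       (\<Sum>g\<in>geometries. x (Weight g)) \<le> 1 / p)"
    by (intro linear_constraints_conj linear_constraints_ball linear_constraints_nonneg
        linear_constraints_eq linear_constraints_le linear_form_diff linear_form_sum
        finite_geometries finite_sides finite \<open>finite S\<close> weight residual extension)
qed

definition calibration_error ::
    "'n geometry set \<Rightarrow> ('n geometry \<Rightarrow> real) \<Rightarrow> ('n geometry \<Rightarrow> real) \<Rightarrow> ('n geometry \<Rightarrow> real) \<Rightarrow> real" where
  "calibration_error S target \<omega> w = (\<Sum>g\<in>S. \<omega> g * \<bar>sum w (extensions g) - target g\<bar>)"

text \<open>The residuals of a feasible point are nonnegative and differ by the calibration error, so their
  sum is at least its absolute value; the positive and negative parts of the error attain it.\<close>

lemma optimal_value_calibration_problem:
  assumes S: "S \<subseteq> geometries" and \<omega>: "\<And>g. g \<in> S \<Longrightarrow> 0 < \<omega> g"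
  shows "optimal_value (calibration_problem p S target \<omega>) =
    (INF w\<in>admissible_weights p. ereal (calibration_error S target \<omega> w))"
proof -
  let ?P = "calibration_problem p S target \<omega>" and ?e = "calibration_error S target \<omega>"
  have lower: "\<exists>w\<in>admissible_weights p. ereal (?e w) \<le> ereal (objective ?P x)"
    if x: "x \<in> feasible ?P" for x
  proof
    have ext: "sum (weights_of x) (extensions g) = (\<Sum>h\<in>extensions g. x (Weight h))" for g
      unfolding weights_of_def by (rule sum_restrict_extensions)
    have all: "sum (weights_of x) geometries = (\<Sum>h\<in>geometries. x (Weight h))"
      by (simp add: weights_of_def)
    show "weights_of x \<in> admissible_weights p"
      using x by (simp add: feasible_calibration_problem[OF S] admissible_weights_def ext all)
        (simp add: weights_of_def)
    have "\<bar>sum (weights_of x) (extensions g) - target g\<bar> \<le> x (ResidualPos g) + x (ResidualNeg g)"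
      if "g \<in> S" for g
      using x that unfolding feasible_calibration_problem[OF S] ext by fastforce
    then have "?e (weights_of x) \<le> objective ?P x"
      unfolding calibration_error_def objective_calibration_problem
      using \<omega> by (intro sum_mono mult_left_mono) (auto intro: less_imp_le)
    then show "ereal (?e (weights_of x)) \<le> ereal (objective ?P x)" by simp
  qed
  have upper: "\<exists>x\<in>feasible ?P. ereal (objective ?P x) \<le> ereal (?e w)"
    if w: "w \<in> admissible_weights p" for w
  proof
    define x where "x = restrict (\<lambda>j. case j of
        Weight g \<Rightarrow> w g
      | ResidualPos g \<Rightarrow> max 0 (sum w (extensions g) - target g)
      | ResidualNeg g \<Rightarrow> max 0 (target g - sum w (extensions g))) (variables ?P)"
    have weight: "x (Weight g) = w g" if "g \<in> geometries" for g
      using that by (simp add: x_def variables_calibration_problem)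
    have residual: "x (ResidualPos g) = max 0 (sum w (extensions g) - target g)"
      "x (ResidualNeg g) = max 0 (target g - sum w (extensions g))" if "g \<in> S" for g
      using that by (simp_all add: x_def variables_calibration_problem)
    have ext: "(\<Sum>h\<in>extensions g. x (Weight h)) = sum w (extensions g)" for g
      using extensions_subset[of g] by (intro sum.cong) (auto simp: weight)
    have split: "a - (max 0 (a - t) - max 0 (t - a)) = t" for a t :: real
      by linarith
    have "x \<in> variables ?P \<rightarrow>\<^sub>E UNIV"
      by (simp add: x_def)
    then show "x \<in> feasible ?P"
      using w split by (simp add: feasible_calibration_problem[OF S] admissible_weights_def weight residual ext)
    have "x (ResidualPos g) + x (ResidualNeg g) = \<bar>sum w (extensions g) - target g\<bar>" if "g \<in> S" for g
      using that by (simp add: residual)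
    then show "ereal (objective ?P x) \<le> ereal (?e w)"
      by (simp add: objective_calibration_problem calibration_error_def)
  qed
  show ?thesis
    unfolding optimal_value_def by (intro antisym INF_mono lower upper)
qed

section \<open>Zero optimal value and exact realizability\<close>

theorem proposition10:
  fixes p\<^sub>0 :: real and S :: "'n::finite geometry set"
    and target \<omega> :: "'n geometry \<Rightarrow> real"
  assumes "0 < p\<^sub>0" and "p\<^sub>0 < 1 / 2"
    and "S \<subseteq> geometries"
    and "\<And>g. g \<in> S \<Longrightarrow> 0 < \<omega> g"
  shows "is_linear_program (calibration_problem p\<^sub>0 S target \<omega>) \<and>
    (optimal_value (calibration_problem p\<^sub>0 S target \<omega>) = 0 \<longleftrightarrow> exactly_realizable p\<^sub>0 S target)"
proof (intro conjI)
  show "is_linear_program (calibration_problem p\<^sub>0 S target \<omega>)"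
    using assms(3) by (rule is_linear_program_calibration_problem)
  let ?K = "admissible_weights p\<^sub>0 :: ('n geometry \<Rightarrow> real) set" and ?e = "calibration_error S target \<omega>"
  have value_eq: "optimal_value (calibration_problem p\<^sub>0 S target \<omega>) = (INF w\<in>?K. ereal (?e w))"
    using assms(3,4) by (rule optimal_value_calibration_problem)
  have nonneg: "0 \<le> ?e w" for w
    using assms(4) unfolding calibration_error_def
    by (intro sum_nonneg mult_nonneg_nonneg) (auto intro: less_imp_le)
  have zero_iff: "?e w = 0 \<longleftrightarrow> (\<forall>g\<in>S. sum w (extensions g) = target g)" for w
  proof -
    have "?e w = 0 \<longleftrightarrow> (\<forall>g\<in>S. \<omega> g * \<bar>sum w (extensions g) - target g\<bar> = 0)"
      unfolding calibration_error_def
      using assms(4) finite_subset[OF assms(3) finite_geometries]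
      by (intro sum_nonneg_eq_0_iff mult_nonneg_nonneg) (auto intro: less_imp_le)
    then show ?thesis
      using assms(4) by force
  qed
  have "(INF w\<in>?K. ereal (?e w)) = 0 \<longleftrightarrow> (\<exists>w\<in>?K. ?e w = 0)"
  proof
    assume inf: "(INF w\<in>?K. ereal (?e w)) = 0"
    \<comment> \<open>An infimum over the empty set would be \<open>\<infinity>\<close>.\<close>
    then have "?K \<noteq> {}"
      by (auto simp: top_ereal_def)
    moreover have "continuous_on ?K ?e"
      unfolding calibration_error_def
      by (intro continuous_intros continuous_on_sum_coordinates)
    ultimately obtain w where w: "w \<in> ?K" "\<forall>w'\<in>?K. ?e w \<le> ?e w'"
      using continuous_attains_inf[OF compact_admissible_weights] by blast
    then have "ereal (?e w) \<le> (INF w\<in>?K. ereal (?e w))"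
      by (intro INF_greatest) simp
    then have "?e w = 0"
      using inf nonneg[of w] by simp
    then show "\<exists>w\<in>?K. ?e w = 0"
      using w by blast
  next
    assume "\<exists>w\<in>?K. ?e w = 0"
    then obtain w where "w \<in> ?K" "?e w = 0" by blast
    then have "(INF w\<in>?K. ereal (?e w)) \<le> 0"
      using INF_lower[of w ?K "\<lambda>w. ereal (?e w)"] by (simp add: zero_ereal_def)
    moreover have "0 \<le> (INF w\<in>?K. ereal (?e w))"
      using nonneg by (intro INF_greatest) simp
    ultimately show "(INF w\<in>?K. ereal (?e w)) = 0"
      by (rule antisym)
  qed
  then show "optimal_value (calibration_problem p\<^sub>0 S target \<omega>) = 0 \<longleftrightarrow> exactly_realizable p\<^sub>0 S target"
    unfolding value_eq exactly_realizable_iff[OF assms(1-3)] zero_iff .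
qed

end
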